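(* Let $k\ge1$. For all $n\ge k+1$, $$N^{k(k-1)\cdots1}_{12\text{-}3}(n)=(k+1)B_{n-k}+\sum_{j=0}^{n-k-2}\left(\binom{n}{k+j}-k\binom{n-k-1}{j}-\binom{n-k}{j}\right)B_{n-k-1-j},$$ together with $N^{k(k-1)\cdots1}_{12\text{-}3}(k)=1$ and $N^{k(k-1)\cdots1}_{12\text{-}3}(n)=0$ for all $1\le n\le k-1$.
   Context: A permutation $\pi=\pi_1\cdots\pi_n$ of $\{1,\dots,n\}$ contains the generalized pattern $12\text{-}3$ if there are indices $i,j$ with $i+1<j\le n$ such that $\pi_i\pi_{i+1}\pi_j$ is order-isomorphic to $123$; otherwise it avoids it. A permutation $\pi$ begins with a pattern $p=p_1\cdots p_k$ if $n\ge k$ and $\pi_1\cdots\pi_k$ is order-isomorphic to $p$. $N^p_q(n)$ is the number of permutations of $\{1,\dots,n\}$ that avoid $q$ and begin with $p$. $B_m$ is the $m$th Bell number (number of set partitions of an $m$-element set, $B_0=1$). An empty sum is $0$. *)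

theory Defs
  imports "HOL-Library.Disjoint_Sets" "HOL-Combinatorics.Multiset_Permutations"
begin

definition order_isomorphic :: "nat list \<Rightarrow> nat list \<Rightarrow> bool" where
  "order_isomorphic xs ys \<longleftrightarrow> length xs = length ys \<and>
     (\<forall>a<length xs. \<forall>b<length xs. xs ! a < xs ! b \<longleftrightarrow> ys ! a < ys ! b)"

(* Permutations of {1..n} are words, i.e. elements of permutations_of_set {1..n};
   list positions count from 0. *)

definition contains_12_3 :: "nat list \<Rightarrow> bool" where
  "contains_12_3 \<pi> \<longleftrightarrow>
     (\<exists>i j. i + 1 < j \<and> j < length \<pi> \<and> order_isomorphic [\<pi> ! i, \<pi> ! (i + 1), \<pi> ! j] [1, 2, 3])"

definition begins_with :: "nat list \<Rightarrow> nat list \<Rightarrow> bool" where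
  "begins_with \<pi> p \<longleftrightarrow> length p \<le> length \<pi> \<and> order_isomorphic (take (length p) \<pi>) p"

definition N_12_3 :: "nat list \<Rightarrow> nat \<Rightarrow> nat" where
  "N_12_3 p n = card {\<pi> \<in> permutations_of_set {1..n}. \<not> contains_12_3 \<pi> \<and> begins_with \<pi> p}"

definition Bell :: "nat \<Rightarrow> nat" where
  "Bell m = card {P. partition_on {1..m} P}"

definition decreasing_pattern :: "nat \<Rightarrow> nat list" where
  "decreasing_pattern k = rev [1..<k + 1]"

end

theory Submission
  imports Defs
begin

text \<open>
  If a permutation \<open>\<pi>\<close> of a finite set is split at its maximum \<open>m\<close> as \<open>\<pi> = D m R\<close>, then \<open>\<pi>\<close> avoids
  12-3 iff \<open>D\<close> is decreasing and \<open>R\<close> avoids 12-3.  Hence \<open>\<pi>\<close> amounts to the set of entries of \<open>D\<close>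
  together with an avoider of the complement, which is the recursion of the Bell numbers.
  Moreover \<open>\<pi>\<close> begins with a decreasing run of length \<open>k \<ge> 1\<close> iff \<open>D\<close> has at least \<open>k\<close> entries, or
  \<open>D\<close> is empty and \<open>R\<close> begins with a decreasing run of length \<open>k - 1\<close>.  Induction on \<open>k\<close> gives
  \<open>N(m + k + 1) = B (m + 1) + (\<Sum>j\<le>m. ((m + k + 1 choose k + j) - (m + 1 choose j)) * B (m - j))\<close>,
  in which the claimed formula is recognised by applying the Bell recursion to
  \<open>k * (\<Sum>j\<le>m. (m choose j) * B (m - j))\<close> and dropping the vanishing term \<open>j = m\<close>.
\<close>

subsection \<open>Bell numbers\<close>

lemma sum_Pow_card:
  fixes g :: "nat \<Rightarrow> 'b::comm_semiring_1"
  assumes "finite T"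
  shows "(\<Sum>A | A \<subseteq> T \<and> P (card A). g (card A))
       = (\<Sum>i | i \<le> card T \<and> P i. of_nat (card T choose i) * g i)"
proof -
  let ?S = "{A. A \<subseteq> T \<and> P (card A)}" and ?I = "{i. i \<le> card T \<and> P i}"
  have "(\<Sum>A\<in>?S. g (card A)) = (\<Sum>i\<in>?I. \<Sum>A | A \<in> ?S \<and> card A = i. g (card A))"
    using assms by (intro sum.group [symmetric]) (auto intro: card_mono)
  also have "\<dots> = (\<Sum>i\<in>?I. of_nat (card T choose i) * g i)"
  proof (rule sum.cong [OF refl])
    fix i assume "i \<in> ?I"
    then have eq: "{A \<in> ?S. card A = i} = {A. A \<subseteq> T \<and> card A = i}"
      by auto
    show "(\<Sum>A | A \<in> ?S \<and> card A = i. g (card A)) = of_nat (card T choose i) * g i"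
      unfolding eq using n_subsets [OF assms, of i] by simp
  qed
  finally show ?thesis .
qed

text \<open>The common shape of both recursions: a subset is removed and the rest is counted by its
  size. \<open>P\<close> is trivial for Bell numbers and a lower bound on the size for
  avoiders.\<close>

lemma sum_Pow_card_diff:
  fixes g :: "nat \<Rightarrow> nat"
  assumes "finite T"
  shows "(\<Sum>A | A \<subseteq> T \<and> P (card A). g (card (T - A)))
       = (\<Sum>i | i \<le> card T \<and> P i. (card T choose i) * g (card T - i))"
proof -
  have "(\<Sum>A | A \<subseteq> T \<and> P (card A). g (card (T - A)))
      = (\<Sum>A | A \<subseteq> T \<and> P (card A). g (card T - card A))"
    using assms by (intro sum.cong) (auto simp: card_Diff_subset finite_subset)
  then show ?thesis
    using sum_Pow_card [OF assms, where P = P and g = "\<lambda>i. g (card T - i)"] by simp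
qed

text \<open>Makes removing the block of \<open>x\<close> reversible. The clause
  \<open>insert x A \<notin> Q\<close> rules out a \<open>Q\<close> that already contains this
  block.\<close>

lemma partition_on_insert_block:
  assumes "x \<notin> T" "A \<subseteq> T"
  shows "partition_on (insert x T) (insert (insert x A) Q) \<and> insert x A \<notin> Q
     \<longleftrightarrow> partition_on (T - A) Q"
proof -
  have diff: "insert x T - insert x A = T - A"
    using assms by auto
  have iff: "partition_on (insert x T) (insert (insert x A) Q) \<longleftrightarrow> partition_on (T - A) Q"
    if "disjnt (insert x A) (\<Union>Q)"
    using partition_on_insert [OF that, of "insert x T"] assms by (auto simp: diff)
  show ?thesis
  proof
    assume P: "partition_on (insert x T) (insert (insert x A) Q) \<and> insert x A \<notin> Q"
    then have "disjnt (insert x A) q" if "q \<in> Q" for q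
      using that by (auto simp: partition_on_def pairwise_insert)
    then have "disjnt (insert x A) (\<Union>Q)"
      by (simp add: disjnt_Union2)
    then show "partition_on (T - A) Q"
      using iff P by simp
  next
    assume Q: "partition_on (T - A) Q"
    then have "\<Union>Q = T - A"
      by (simp add: partition_on_def)
    then have "disjnt (insert x A) (\<Union>Q)" "insert x A \<notin> Q"
      using assms by (auto simp: disjnt_def)
    then show "partition_on (insert x T) (insert (insert x A) Q) \<and> insert x A \<notin> Q"
      using iff Q by simp
  qed
qed

text \<open>Partitions are classified by the block of \<open>x\<close>: \<open>A\<close> is the rest
  of that block, \<open>Q\<close> the set of the other blocks.\<close>

lemma card_partitions_insert:
  assumes "finite T" "x \<notin> T"
  shows "card {P. partition_on (insert x T) P} = (\<Sum>A | A \<subseteq> T. card {Q. partition_on (T - A) Q})"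
proof -
  let ?X = "SIGMA A:{A. A \<subseteq> T}. {Q. partition_on (T - A) Q}"
  let ?h = "\<lambda>(A, Q). insert (insert x A) Q"
  have "bij_betw ?h ?X {P. partition_on (insert x T) P}"
    unfolding bij_betw_def
  proof
    \<comment> \<open>Exactly one block contains \<open>x\<close>, so \<open>A\<close> can be read
      off the image.\<close>
    have block: "{B \<in> insert (insert x A) Q. x \<in> B} = {insert x A}"
      if "A \<subseteq> T" "partition_on (T - A) Q" for A Q
      using that assms by (auto simp: partition_on_def)
    show "inj_on ?h ?X"
    proof (rule inj_onI, clarsimp)
      fix A Q A' Q'
      assume A: "A \<subseteq> T" "partition_on (T - A) Q" and A': "A' \<subseteq> T" "partition_on (T - A') Q'"
        and eq: "insert (insert x A) Q = insert (insert x A') Q'"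
      have "insert x A = insert x A'"
        using block [OF A] block [OF A'] eq by simp
      then have "A = A'"
        using A A' assms by (metis insert_ident subsetD)
      moreover have "insert x A \<notin> Q" "insert x A \<notin> Q'"
        using partition_on_insert_block [OF assms(2) A(1), THEN iffD2] A(2) A'(2) \<open>A = A'\<close>
        by simp_all
      ultimately show "A = A' \<and> Q = Q'"
        using eq by (simp add: insert_ident)
    qed
    show "?h ` ?X = {P. partition_on (insert x T) P}"
    proof safe
      fix A Q assume "A \<subseteq> T" "partition_on (T - A) Q"
      then show "partition_on (insert x T) (insert (insert x A) Q)"
        using partition_on_insert_block [OF assms(2), THEN iffD2] by simp
    next
      fix P assume P: "partition_on (insert x T) P"
      then obtain B where B: "B \<in> P" "x \<in> B"
        by (auto simp: partition_on_def)
      have A: "B - {x} \<subseteq> T"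
        using P B by (auto simp: partition_on_def)
      have eq: "insert (insert x (B - {x})) (P - {B}) = P"
        using B by (auto simp: insert_absorb)
      have "partition_on (T - (B - {x})) (P - {B})"
        using partition_on_insert_block [OF assms(2) A, of "P - {B}"] P B eq
        by (simp add: insert_absorb)
      then show "P \<in> ?h ` ?X"
        using A eq by (intro image_eqI [where x = "(B - {x}, P - {B})"]) auto
    qed
  qed
  then have "card {P. partition_on (insert x T) P} = card ?X"
    by (metis bij_betw_same_card)
  also have "\<dots> = (\<Sum>A | A \<subseteq> T. card {Q. partition_on (T - A) Q})"
    using assms by (intro card_SigmaI) (auto intro: finitely_many_partition_on)
  finally show ?thesis .
qed

text \<open>A bijection of the ground sets carries partitions over block by block. By symmetry the
  inequality already yields equality.\<close>

lemma card_partitions_le: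
  assumes "finite S" "finite S'" "card S = card S'"
  shows "card {P. partition_on S P} \<le> card {P. partition_on S' P}"
proof -
  obtain f where f: "bij_betw f S S'"
    using finite_same_card_bij [OF assms] by blast
  have "inj_on ((`) ((`) f)) {P. partition_on S P}"
  proof (rule inj_on_image)
    show "inj_on ((`) f) (\<Union>{P. partition_on S P})"
      using f by (intro inj_on_image) (auto simp: partition_on_def bij_betw_def intro: inj_on_subset)
  qed
  moreover have "partition_on S' ((`) f ` P)" if "partition_on S P" for P
  proof -
    \<comment> \<open>\<open>partition_on_inj_image\<close> discards empty blocks from the image;
      here none arise.\<close>
    have "(`) f ` P - {{}} = (`) f ` P"
      using partition_onD3 [OF that] by auto
    then show ?thesis
      using partition_on_inj_image [OF that, of f] f by (simp add: bij_betw_def)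
  qed
  ultimately show ?thesis
    using assms by (intro card_inj_on_le) (auto intro: finitely_many_partition_on)
qed

lemma card_partitions_eq_Bell:
  assumes "finite S"
  shows "card {P. partition_on S P} = Bell (card S)"
  unfolding Bell_def using assms by (intro antisym card_partitions_le) auto

lemma Bell_0: "Bell 0 = 1"
  by (simp add: Bell_def partition_on_empty)

lemma Bell_Suc: "Bell (Suc n) = (\<Sum>i\<le>n. (n choose i) * Bell (n - i))"
proof -
  \<comment> \<open>The extra element is \<open>0\<close>, so that the remaining ground set is
    exactly \<open>{1..n}\<close>.\<close>
  have "Bell (Suc n) = card {P. partition_on (insert 0 {1..n}) P}"
    by (subst card_partitions_eq_Bell) auto
  also have "\<dots> = (\<Sum>A | A \<subseteq> {1..n} \<and> True. Bell (card ({1..n} - A)))"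
    by (subst card_partitions_insert) (auto simp: card_partitions_eq_Bell)
  also have "\<dots> = (\<Sum>i | i \<le> card {1..n} \<and> True. (card {1..n} choose i) * Bell (card {1..n} - i))"
    by (rule sum_Pow_card_diff) simp
  finally show ?thesis
    by (simp add: atMost_def)
qed

subsection \<open>Avoiders split at their maximum\<close>

lemma contains_12_3_iff:
  "contains_12_3 \<pi> \<longleftrightarrow>
     (\<exists>i j. i + 1 < j \<and> j < length \<pi> \<and> \<pi> ! i < \<pi> ! (i + 1) \<and> \<pi> ! (i + 1) < \<pi> ! j)"
proof -
  have "order_isomorphic [a, b, c] [1, 2, 3] \<longleftrightarrow> a < b \<and> b < c" for a b c :: nat
    by (auto simp: order_isomorphic_def All_less_Suc numeral_3_eq_3)
  then show ?thesis
    by (simp add: contains_12_3_def)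
qed

lemma contains_12_3_Nil: "\<not> contains_12_3 []"
  by (simp add: contains_12_3_iff)

lemma contains_12_3_singleton: "\<not> contains_12_3 [x]"
  by (simp add: contains_12_3_iff)

text \<open>An occurrence either lies in the tail or starts at the first letter, and then its
  adjacent pair is \<open>x\<close>, \<open>y\<close>.\<close>

lemma contains_12_3_Cons:
  "contains_12_3 (x # y # ys) \<longleftrightarrow> contains_12_3 (y # ys) \<or> (x < y \<and> (\<exists>z\<in>set ys. y < z))"
proof
  assume "contains_12_3 (x # y # ys)"
  then obtain i j where ij: "i + 1 < j" "j < length (x # y # ys)"
    "(x # y # ys) ! i < (x # y # ys) ! (i + 1)" "(x # y # ys) ! (i + 1) < (x # y # ys) ! j"
    unfolding contains_12_3_iff by blast
  have "j = Suc (Suc (j - 2))"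
    using ij(1) by simp
  then obtain j' where j': "j = Suc (Suc j')" ..
  show "contains_12_3 (y # ys) \<or> (x < y \<and> (\<exists>z\<in>set ys. y < z))"
  proof (cases i)
    case 0
    then show ?thesis
      using ij j' by auto
  next
    case (Suc i')
    then have "contains_12_3 (y # ys)"
      unfolding contains_12_3_iff using ij j' by (intro exI [of _ i'] exI [of _ "Suc j'"]) auto
    then show ?thesis ..
  qed
next
  assume "contains_12_3 (y # ys) \<or> (x < y \<and> (\<exists>z\<in>set ys. y < z))"
  then show "contains_12_3 (x # y # ys)"
  proof
    assume "contains_12_3 (y # ys)"
    then obtain i j where "i + 1 < j" "j < length (y # ys)"
      "(y # ys) ! i < (y # ys) ! (i + 1)" "(y # ys) ! (i + 1) < (y # ys) ! j"
      unfolding contains_12_3_iff by blast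
    then show ?thesis
      unfolding contains_12_3_iff by (intro exI [of _ "Suc i"] exI [of _ "Suc j"]) auto
  next
    assume "x < y \<and> (\<exists>z\<in>set ys. y < z)"
    then obtain j where "x < y" "j < length ys" "y < ys ! j"
      by (auto simp: in_set_conv_nth)
    then show ?thesis
      unfolding contains_12_3_iff by (intro exI [of _ 0] exI [of _ "Suc (Suc j)"]) auto
  qed
qed

lemma contains_12_3_Cons_max:
  assumes "\<forall>z\<in>set R. z < m"
  shows "contains_12_3 (m # R) \<longleftrightarrow> contains_12_3 R"
proof (cases R)
  case Nil
  then show ?thesis
    by (simp add: contains_12_3_Nil contains_12_3_singleton)
next
  case (Cons y ys)
  then show ?thesis
    using assms by (auto simp: contains_12_3_Cons)
qed

text \<open>An ascent inside \<open>D\<close> is completed by \<open>m\<close>. If \<open>D\<close>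
  is decreasing, the only ascent starting in \<open>D\<close> ends in \<open>m\<close>, and no
  letter exceeds \<open>m\<close>. Distinctness turns the absence of ascents into strict
  decrease.\<close>

lemma contains_12_3_split_max:
  assumes "\<forall>z\<in>set D \<union> set R. z < m" "distinct D"
  shows "contains_12_3 (D @ m # R) \<longleftrightarrow> \<not> sorted_wrt (>) D \<or> contains_12_3 R"
  using assms
proof (induction D)
  case Nil
  then show ?case
    by (simp add: contains_12_3_Cons_max)
next
  case (Cons x D)
  show ?case
  proof (cases D)
    case Nil
    then show ?thesis
      using Cons by (force simp: contains_12_3_Cons contains_12_3_Cons_max)
  next
    case (Cons y E)
    \<comment> \<open>The larger letter required after \<open>y\<close> is always available, namely
      \<open>m\<close>.\<close>
    have "contains_12_3 (x # D @ m # R) \<longleftrightarrow> contains_12_3 (D @ m # R) \<or> x < y"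
      using Cons.prems Cons by (auto simp: contains_12_3_Cons)
    moreover have "sorted_wrt (>) (x # D) \<longleftrightarrow> sorted_wrt (>) D \<and> \<not> x < y"
      using Cons.prems Cons by (auto dest: order.strict_trans)
    ultimately show ?thesis
      using Cons.IH Cons.prems by auto
  qed
qed

text \<open>The ground set is arbitrary because the recursion passes to complements
  \<open>T - A\<close>, which need not be intervals.\<close>

definition avoiders :: "nat \<Rightarrow> nat set \<Rightarrow> nat list set" where
  "avoiders k S =
     {\<pi> \<in> permutations_of_set S. \<not> contains_12_3 \<pi> \<and> k \<le> length \<pi> \<and> sorted_wrt (>) (take k \<pi>)}"

lemma finite_avoiders: "finite (avoiders k S)"
  by (simp add: avoiders_def)

lemma rev_sorted_list_of_set_unique:
  fixes D :: "'a::linorder list"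
  assumes "sorted_wrt (>) D"
  shows "rev (sorted_list_of_set (set D)) = D"
proof -
  have "sorted_wrt (<) (rev D)"
    using assms by (simp add: sorted_wrt_rev)
  then have "sorted_list_of_set (set (rev D)) = rev D"
    by (intro sorted_list_of_set.idem_if_sorted_distinct) (auto simp: strict_sorted_iff)
  then show ?thesis
    by simp
qed

text \<open>\<open>A\<close> is the set of entries left of \<open>m\<close>, and
  \<open>max 1 k\<close> keeps the empty set out of the sum even for \<open>k = 0\<close>. Empty
  \<open>A\<close> gives the first summand: after the leading \<open>m\<close>, a decreasing run of
  length \<open>k - 1\<close> remains to be required, which for \<open>k = 0\<close> is no
  condition.\<close>

lemma card_avoiders_insert_max:
  assumes "finite T" and less: "\<forall>t\<in>T. t < m"
  shows "card (avoiders k (insert m T)) = card (avoiders (k - 1) T)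
           + (\<Sum>A | A \<subseteq> T \<and> max 1 k \<le> card A. card (avoiders 0 (T - A)))"
proof -
  let ?Y = "{A. A \<subseteq> T \<and> max 1 k \<le> card A}"
  let ?X = "SIGMA A:?Y. avoiders 0 (T - A)"
  let ?h = "\<lambda>(A, R). rev (sorted_list_of_set A) @ m # R"
  have "m \<notin> T"
    using less by blast
  have sorted_rev: "sorted_wrt (>) (rev (sorted_list_of_set A))" for A :: "nat set"
    by (simp add: sorted_wrt_rev)
  have inj: "inj_on ?h ?X"
  proof (rule inj_onI, clarsimp)
    fix A R A' R'
    assume A: "A \<subseteq> T" "A' \<subseteq> T"
      and eq: "rev (sorted_list_of_set A) @ m # R = rev (sorted_list_of_set A') @ m # R'"
    have fin: "finite A" "finite A'"
      using A assms finite_subset by blast+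
    \<comment> \<open>Since \<open>m\<close> is not in \<open>T\<close>, the letters before the
      first \<open>m\<close> recover \<open>A\<close>.\<close>
    have "takeWhile (\<lambda>z. z \<noteq> m) (rev (sorted_list_of_set A) @ m # R) = rev (sorted_list_of_set A)"
      "takeWhile (\<lambda>z. z \<noteq> m) (rev (sorted_list_of_set A') @ m # R') = rev (sorted_list_of_set A')"
      using A fin \<open>m \<notin> T\<close> by (auto simp: takeWhile_append)
    then have "sorted_list_of_set A = sorted_list_of_set A'"
      using eq by simp
    then show "A = A' \<and> R = R'"
      using eq fin by (metis append_same_eq list.inject same_append_eq sorted_list_of_set.set_sorted_key_list_of_set)
  qed
  have split: "avoiders k (insert m T) = (#) m ` avoiders (k - 1) T \<union> ?h ` ?X"
  proof safe
    fix \<pi> assume \<pi>: "\<pi> \<in> avoiders k (insert m T)" and not: "\<pi> \<notin> ?h ` ?X"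
    then have set: "set \<pi> = insert m T" and dist: "distinct \<pi>" and av: "\<not> contains_12_3 \<pi>"
      and len: "k \<le> length \<pi>" and dec: "sorted_wrt (>) (take k \<pi>)"
      by (auto simp: avoiders_def permutations_of_set_def)
    obtain D R where DR: "\<pi> = D @ m # R"
      using set split_list by (metis insertI1)
    have D: "set D \<subseteq> T" and R: "set R = T - set D" and dD: "distinct D"
      using set dist DR \<open>m \<notin> T\<close> by auto
    have sD: "sorted_wrt (>) D" and aR: "\<not> contains_12_3 R"
      using av contains_12_3_split_max [of D R m] less D R dD unfolding DR by auto
    have R0: "R \<in> avoiders 0 (T - set D)"
      using R dist DR aR by (auto simp: avoiders_def permutations_of_set_def)
    have \<pi>_eq: "\<pi> = ?h (set D, R)"
      using DR sD by (simp add: rev_sorted_list_of_set_unique)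
    have "\<not> max 1 k \<le> length D"
      using not \<pi>_eq R0 D dD by (auto simp: distinct_card)
    \<comment> \<open>If \<open>D\<close> were nonempty but shorter than \<open>k\<close>, its last
      letter and \<open>m\<close> would form an ascent within the first \<open>k\<close>
      letters.\<close>
    moreover have "D = []" if "\<not> k \<le> length D"
    proof (rule ccontr)
      assume "D \<noteq> []"
      then obtain E y where E: "D = E @ [y]"
        by (metis rev_exhaust)
      then have "take k \<pi> = E @ y # m # take (k - length D - 1) R"
        using that DR by (simp add: take_Cons')
      then have "m < y"
        using dec by (auto simp: sorted_wrt_append)
      then show False
        using D E less by auto
    qed
    ultimately have "D = []"
      by (cases "k \<le> length D") (auto simp: not_le less_Suc_eq_0_disj Suc_le_eq)
    then have "R \<in> avoiders (k - 1) T"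
      using R0 DR len dec by (cases k) (auto simp: avoiders_def)
    then show "\<pi> \<in> (#) m ` avoiders (k - 1) T"
      using DR \<open>D = []\<close> by simp
  next
    fix R assume "R \<in> avoiders (k - 1) T"
    then show "m # R \<in> avoiders k (insert m T)"
      using less \<open>m \<notin> T\<close> contains_12_3_Cons_max [of R m]
      by (cases k) (auto simp: avoiders_def permutations_of_set_def dest: in_set_takeD)
  next
    fix A R assume A: "A \<subseteq> T" "max 1 k \<le> card A" and R: "R \<in> avoiders 0 (T - A)"
    have fin: "finite A"
      using A assms finite_subset by blast
    have "\<not> contains_12_3 (rev (sorted_list_of_set A) @ m # R)"
      using contains_12_3_split_max [of "rev (sorted_list_of_set A)" R m] A R less fin sorted_rev
      by (auto simp: avoiders_def permutations_of_set_def)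
    moreover have "take k (rev (sorted_list_of_set A) @ m # R) = take k (rev (sorted_list_of_set A))"
      using A by simp
    moreover have "sorted_wrt (>) (take k (rev (sorted_list_of_set A)))"
      using sorted_rev sorted_wrt_take by blast
    ultimately show "rev (sorted_list_of_set A) @ m # R \<in> avoiders k (insert m T)"
      using A R fin \<open>m \<notin> T\<close> by (auto simp: avoiders_def permutations_of_set_def)
  qed
  have disj: "(#) m ` avoiders (k - 1) T \<inter> ?h ` ?X = {}"
  proof (rule equals0I)
    fix \<pi> assume "\<pi> \<in> (#) m ` avoiders (k - 1) T \<inter> ?h ` ?X"
    then obtain R' where R': "\<pi> = m # R'" and "\<pi> \<in> ?h ` ?X"
      by blast
    then obtain A R where A: "A \<subseteq> T" "max 1 k \<le> card A"
      and R: "\<pi> = rev (sorted_list_of_set A) @ m # R"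
      by auto
    have "finite A"
      using A assms finite_subset by blast
    moreover have "A \<noteq> {}"
      using A by auto
    ultimately have "rev (sorted_list_of_set A) \<noteq> []" "set (rev (sorted_list_of_set A)) = A"
      by auto
    \<comment> \<open>The first letter is \<open>m\<close> in one description and an element of
      \<open>A\<close> in the other.\<close>
    then have "m \<in> A"
      using R R' by (metis hd_append2 hd_in_set list.sel(1))
    then show False
      using A \<open>m \<notin> T\<close> by blast
  qed
  have fin: "finite ?X"
    using assms by (intro finite_SigmaI) (auto simp: finite_avoiders)
  have "card (avoiders k (insert m T)) = card (avoiders (k - 1) T) + card ?X"
    unfolding split using disj fin inj
    by (simp add: card_Un_disjoint finite_avoiders card_image)
  also have "card ?X = (\<Sum>A\<in>?Y. card (avoiders 0 (T - A)))"
    using assms by (intro card_SigmaI) (auto simp: finite_avoiders)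
  finally show ?thesis .
qed

lemma avoiders_0_empty: "avoiders 0 {} = {[]}"
  by (auto simp: avoiders_def contains_12_3_Nil)

lemma split_Max:
  fixes S :: "nat set"
  assumes "finite S" "S \<noteq> {}"
  obtains m T where "S = insert m T" "finite T" "\<forall>t\<in>T. t < m" "card S = Suc (card T)"
proof
  show "S = insert (Max S) (S - {Max S})"
    using assms by (simp add: insert_absorb)
  show "\<forall>t\<in>S - {Max S}. t < Max S"
    using assms by (auto simp: less_le)
  show "card S = Suc (card (S - {Max S}))"
    using assms by (intro card.remove) auto
qed (use assms in auto)

lemma card_avoiders_0: "finite S \<Longrightarrow> card (avoiders 0 S) = Bell (card S)"
proof (induction "card S" arbitrary: S rule: less_induct)
  case less
  show ?case
  proof (cases "S = {}")
    case True
    then show ?thesis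
      by (simp add: avoiders_0_empty Bell_0)
  next
    case False
    with less.prems obtain m T
      where T: "S = insert m T" "finite T" "\<forall>t\<in>T. t < m" "card S = Suc (card T)"
      by (rule split_Max)
    have IH: "card (avoiders 0 (T - A)) = Bell (card (T - A))" for A
      using T less.hyps by (simp add: card_mono le_imp_less_Suc)
    have "card (avoiders 0 S) = card (avoiders 0 T)
        + (\<Sum>A | A \<subseteq> T \<and> 1 \<le> card A. card (avoiders 0 (T - A)))"
      using card_avoiders_insert_max [OF T(2,3), of 0] T(1) by simp
    also have "\<dots> = Bell (card T) + (\<Sum>i | i \<le> card T \<and> 1 \<le> i. (card T choose i) * Bell (card T - i))"
      using IH [of "{}"] sum_Pow_card_diff [OF T(2), where P = "\<lambda>i. 1 \<le> i" and g = Bell] by (simp add: IH)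
    \<comment> \<open>The separate summand \<open>Bell (card T)\<close> is the missing term
      \<open>i = 0\<close> of the Bell recursion.\<close>
    also have "\<dots> = (\<Sum>i\<in>insert 0 {i. i \<le> card T \<and> 1 \<le> i}. (card T choose i) * Bell (card T - i))"
      by (subst sum.insert) auto
    also have "insert 0 {i. i \<le> card T \<and> 1 \<le> i} = {..card T}"
      by auto
    finally show ?thesis
      using T by (simp add: Bell_Suc)
  qed
qed

subsection \<open>The formula\<close>

lemma card_avoiders_Suc:
  assumes "finite T" "\<forall>t\<in>T. t < m"
  shows "card (avoiders (Suc k) (insert m T))
       = card (avoiders k T) + (\<Sum>i=Suc k..card T. (card T choose i) * Bell (card T - i))"
proof -
  have "(\<Sum>A | A \<subseteq> T \<and> max 1 (Suc k) \<le> card A. card (avoiders 0 (T - A)))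
      = (\<Sum>A | A \<subseteq> T \<and> Suc k \<le> card A. Bell (card (T - A)))"
    using assms by (intro sum.cong) (auto simp: card_avoiders_0)
  also have "\<dots> = (\<Sum>i | i \<le> card T \<and> Suc k \<le> i. (card T choose i) * Bell (card T - i))"
    by (rule sum_Pow_card_diff [OF assms(1)])
  also have "{i. i \<le> card T \<and> Suc k \<le> i} = {Suc k..card T}"
    by auto
  finally show ?thesis
    using card_avoiders_insert_max [OF assms, of "Suc k"] by simp
qed

text \<open>Removing the maximum lowers the size and \<open>k\<close> together, so \<open>m\<close>
  stays fixed in the induction. For \<open>k = 0\<close> every summand vanishes and
  \<open>card_avoiders_0\<close> applies.\<close>

lemma card_avoiders:
  assumes "finite S" "card S = m + k + 1"
  shows "int (card (avoiders k S)) = int (Bell (m + 1))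
       + (\<Sum>j\<le>m. (int (m + k + 1 choose (k + j)) - int (m + 1 choose j)) * int (Bell (m - j)))"
  using assms
proof (induction k arbitrary: S)
  case 0
  then show ?case
    by (simp add: card_avoiders_0)
next
  case (Suc k)
  from Suc.prems have "S \<noteq> {}"
    by auto
  with Suc.prems(1) obtain x T
    where T: "S = insert x T" "finite T" "\<forall>t\<in>T. t < x" "card S = Suc (card T)"
    by (rule split_Max)
  have cT: "card T = m + k + 1"
    using T Suc.prems by simp
  have "(\<Sum>i=Suc k..card T. (card T choose i) * Bell (card T - i))
      = (\<Sum>j\<le>m. (m + k + 1 choose (Suc k + j)) * Bell (m - j))"
    by (rule sum.reindex_bij_witness [of _ "\<lambda>j. Suc k + j" "\<lambda>i. i - Suc k"]) (auto simp: cT)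
  then have "int (card (avoiders (Suc k) S)) = int (card (avoiders k T))
      + (\<Sum>j\<le>m. int (m + k + 1 choose (Suc k + j)) * int (Bell (m - j)))"
    using card_avoiders_Suc [OF T(2,3), of k] T(1) by simp
  also have "\<dots> = int (Bell (m + 1))
      + (\<Sum>j\<le>m. (int (m + k + 1 choose (k + j)) - int (m + 1 choose j)) * int (Bell (m - j))
               + int (m + k + 1 choose (Suc k + j)) * int (Bell (m - j)))"
    using Suc.IH [OF T(2) cT] by (simp add: sum.distrib)
  \<comment> \<open>Pascal's rule merges the two binomials with top
    \<open>m + k + 1\<close>.\<close>
  also have "\<dots> = int (Bell (m + 1))
      + (\<Sum>j\<le>m. (int (m + Suc k + 1 choose (Suc k + j)) - int (m + 1 choose j)) * int (Bell (m - j)))"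
    by (simp add: algebra_simps)
  finally show ?case .
qed

text \<open>The boundary case outside \<open>card_avoiders\<close>, whose ground set has more than
  \<open>k\<close> elements.\<close>

lemma card_avoiders_full: "finite S \<Longrightarrow> card (avoiders (card S) S) = 1"
proof (induction "card S" arbitrary: S)
  case 0
  then show ?case
    by (simp add: avoiders_0_empty)
next
  case (Suc n)
  from Suc.hyps(2) have "S \<noteq> {}"
    by auto
  with Suc.prems(1) obtain x T
    where T: "S = insert x T" "finite T" "\<forall>t\<in>T. t < x" "card S = Suc (card T)"
    by (rule split_Max)
  then show ?case
    \<comment> \<open>With \<open>card T\<close> for \<open>k\<close>, the sum ranges over the empty
      interval \<open>{Suc (card T)..card T}\<close>.\<close>
    using card_avoiders_Suc [OF T(2,3), of "card T"] Suc.hyps(1) [of T] Suc.hyps(2) by simp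
qed

lemma begins_with_decreasing_pattern:
  "begins_with \<pi> (decreasing_pattern k) \<longleftrightarrow> k \<le> length \<pi> \<and> sorted_wrt (>) (take k \<pi>)"
proof (cases "k \<le> length \<pi>")
  case True
  \<comment> \<open>With positions counted from 0 the pattern has \<open>k - a\<close> at position
    \<open>a\<close>, so order isomorphism means that values reverse the order of positions.\<close>
  have "decreasing_pattern k ! a = k - a" if "a < k" for a
    using that by (simp add: decreasing_pattern_def rev_nth del: upt_Suc)
  moreover have "length (decreasing_pattern k) = k"
    by (simp add: decreasing_pattern_def del: upt_Suc)
  ultimately have "begins_with \<pi> (decreasing_pattern k)
      \<longleftrightarrow> (\<forall>a<k. \<forall>b<k. \<pi> ! a < \<pi> ! b \<longleftrightarrow> k - a < k - b)"
    using True by (auto simp: begins_with_def order_isomorphic_def)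
  also have "\<dots> \<longleftrightarrow> (\<forall>a<k. \<forall>b<k. \<pi> ! a < \<pi> ! b \<longleftrightarrow> b < a)"
    by (auto simp: diff_less_mono2)
  also have "\<dots> \<longleftrightarrow> (\<forall>a b. a < b \<longrightarrow> b < k \<longrightarrow> \<pi> ! b < \<pi> ! a)"
  proof
    assume dec: "\<forall>a b. a < b \<longrightarrow> b < k \<longrightarrow> \<pi> ! b < \<pi> ! a"
    have "\<pi> ! a < \<pi> ! b \<longleftrightarrow> b < a" if "a < k" "b < k" for a b
      using dec that by (cases a b rule: linorder_cases) (auto dest: less_asym)
    then show "\<forall>a<k. \<forall>b<k. \<pi> ! a < \<pi> ! b \<longleftrightarrow> b < a"
      by blast
  qed auto
  also have "\<dots> \<longleftrightarrow> sorted_wrt (>) (take k \<pi>)"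
    using True by (auto simp: sorted_wrt_iff_nth_less)
  finally show ?thesis
    using True by simp
next
  case False
  then show ?thesis
    by (simp add: begins_with_def decreasing_pattern_def del: upt_Suc)
qed

lemma N_12_3_decreasing_pattern: "N_12_3 (decreasing_pattern k) n = card (avoiders k {1..n})"
  by (simp add: N_12_3_def avoiders_def begins_with_decreasing_pattern)

theorem proposition9:
  fixes k :: nat
  assumes "k \<ge> 1"
  shows "(\<forall>n\<ge>k + 1. int (N_12_3 (decreasing_pattern k) n) =
            (int k + 1) * int (Bell (n - k)) +
            (\<Sum>j | j + k + 2 \<le> n.
               (int (n choose (k + j)) - int k * int ((n - k - 1) choose j) - int ((n - k) choose j))
               * int (Bell (n - k - 1 - j))))
       \<and> N_12_3 (decreasing_pattern k) k = 1
       \<and> (\<forall>n. 1 \<le> n \<and> n \<le> k - 1 \<longrightarrow> N_12_3 (decreasing_pattern k) n = 0)"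
proof (intro conjI allI impI)
  fix n assume "k + 1 \<le> n"
  then obtain m where n: "n = m + k + 1"
    by (metis add.assoc add.commute le_Suc_ex)
  let ?c = "\<lambda>j. (int (m + k + 1 choose (k + j)) - int k * int (m choose j) - int (m + 1 choose j))
               * int (Bell (m - j))"
  \<comment> \<open>At \<open>j = m\<close> the coefficient is
    \<open>(m + k + 1) - k - (m + 1) = 0\<close>.\<close>
  have "m + k + 1 choose (k + m) = m + k + 1"
    using binomial_symmetric [of "k + m" "m + k + 1"] by simp
  then have zero: "?c m = 0"
    using binomial_symmetric [of m "m + 1"] by simp
  have "int (N_12_3 (decreasing_pattern k) n) = int (Bell (m + 1))
       + (\<Sum>j\<le>m. (int (m + k + 1 choose (k + j)) - int (m + 1 choose j)) * int (Bell (m - j)))"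
    unfolding N_12_3_decreasing_pattern n by (rule card_avoiders) auto
  \<comment> \<open>The term with factor \<open>k\<close> is subtracted inside \<open>?c\<close> and
    added back; the added part sums to \<open>k\<close> times \<open>Bell (m + 1)\<close>.\<close>
  also have "\<dots> = int (Bell (m + 1)) + (\<Sum>j\<le>m. ?c j + int k * (int (m choose j) * int (Bell (m - j))))"
    by (intro arg_cong2 [where f = "(+)"] sum.cong) (auto simp: algebra_simps)
  also have "\<dots> = int (Bell (m + 1)) + ((\<Sum>j\<le>m. ?c j) + int k * int (Bell (m + 1)))"
    by (simp only: sum.distrib) (simp add: Bell_Suc sum_distrib_left)
  also have "\<dots> = (int k + 1) * int (Bell (m + 1)) + (\<Sum>j\<le>m. ?c j)"
    by (simp only: algebra_simps)
  \<comment> \<open>The condition \<open>j + k + 2 \<le> n\<close> says \<open>j < m\<close>, so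
    just the vanishing term \<open>j = m\<close> is lost; for \<open>m = 0\<close> the new range is
    empty.\<close>
  also have "(\<Sum>j\<le>m. ?c j) = (\<Sum>j | j + k + 2 \<le> n. ?c j)"
  proof (rule sum.mono_neutral_right)
    show "\<forall>j\<in>{..m} - {j. j + k + 2 \<le> n}. ?c j = 0"
    proof
      fix j assume "j \<in> {..m} - {j. j + k + 2 \<le> n}"
      then have "j = m"
        by (auto simp: n)
      then show "?c j = 0"
        using zero by (simp only:)
    qed
  qed (auto simp: n)
  finally show "int (N_12_3 (decreasing_pattern k) n) =
            (int k + 1) * int (Bell (n - k)) +
            (\<Sum>j | j + k + 2 \<le> n.
               (int (n choose (k + j)) - int k * int ((n - k - 1) choose j) - int ((n - k) choose j))
               * int (Bell (n - k - 1 - j)))"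
    by (simp add: n)
next
  show "N_12_3 (decreasing_pattern k) k = 1"
    using card_avoiders_full [of "{1..k}"] by (simp add: N_12_3_decreasing_pattern)
next
  fix n assume n: "1 \<le> n \<and> n \<le> k - 1"
  have "length \<pi> = n" if "\<pi> \<in> permutations_of_set {1..n}" for \<pi>
    using length_finite_permutations_of_set [OF that] by simp
  then have "avoiders k {1..n} = {}"
    using n by (fastforce simp: avoiders_def)
  then show "N_12_3 (decreasing_pattern k) n = 0"
    by (simp add: N_12_3_decreasing_pattern)
qed

end
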